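(* Let $t\in\mathbb{R}$, let $\widetilde W$ be an $N\times N$ matrix weight supported on $\mathbb{R}$ with monic orthogonal polynomials $(\widetilde P(x,n))_{n\ge0}$, and let $A\in M_N(\mathbb{C})$ be a matrix such that $$\mathcal{D}=\partial_x+A\in\mathcal{F}_R(\widetilde P),\qquad \mathcal{D}^\dagger=-\mathcal{D}+2x+t,$$ where $\mathcal{D}^\dagger$ is the adjoint of $\mathcal{D}$ with respect to $\widetilde W$. Assume moreover that $$\widetilde{\mathcal{H}}(0)=\int_{-\infty}^\infty\widetilde W(x)\,dx=\int_{-\infty}^\infty e^{-x^2-xt}e^{xA}e^{xA^*}\,dx.$$ Then there is an invertible constant matrix $K$ such that $W(x)=K\,\widetilde W(x)\,K^*$ for almost every $x\in\mathbb{R}$ with respect to Lebesgue measure, where $$W(x)=e^{-x^2-xt}e^{xA}e^{xA^*}.$$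
   Context: A matrix weight on $\mathbb{R}$ is a positive definite $M_N(\mathbb{C})$-valued weight function with finite moments of all orders. The inner product is $\langle H,G\rangle=\int_{\mathbb{R}}H(y)\widetilde W(y)G(y)^*\,dy$, and $\widetilde P(x,n)=x^nI+\cdots$ are the monic polynomials with $\langle\widetilde P(\cdot,n),\widetilde P(\cdot,m)\rangle=\widetilde{\mathcal{H}}(n)\delta_{n,m}$. Differential operators with rational matrix coefficients act from the right: $F\cdot\sum_j\partial_x^jF_j(x)=\sum_jF^{(j)}(x)F_j(x)$. $\mathcal{D}^\dagger$ is the adjoint of $\mathcal{D}$ if $\langle F\cdot\mathcal{D},G\rangle=\langle F,G\cdot\mathcal{D}^\dagger\rangle$ for all matrix valued polynomials $F,G$. $\mathcal{F}_R(\widetilde P)$ is the set of such differential operators $\mathcal{D}$ for which there are finitely many sequences $A_j:\mathbb{N}_0\to M_N(\mathbb{C})$, $-\ell\le j\le m$, with $(\widetilde P\cdot\mathcal{D})(x,n)=\sum_{j=-\ell}^mA_j(n)\widetilde P(x,n+j)$ for all $n\ge0$ (with $\widetilde P(x,n)=0$ for $n<0$). *)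

theory Defs
  imports "HOL-Analysis.Analysis" "HOL-Computational_Algebra.Polynomial_Factorial"
    "HOL-Computational_Algebra.Field_as_Ring"
begin

section \<open>Complex matrices\<close>

definition cadjoint :: "complex^'n^'n \<Rightarrow> complex^'n^'n" where
  "cadjoint A = map_matrix cnj (transpose A)"

definition pos_def :: "complex^'n^'n \<Rightarrow> bool" where
  "pos_def A \<longleftrightarrow> cadjoint A = A \<and>
     (\<forall>v. v \<noteq> 0 \<longrightarrow> 0 < Re (\<Sum>i\<in>UNIV. \<Sum>j\<in>UNIV. cnj (v $ i) * A $ i $ j * v $ j))"

text \<open>Multiplication and powers of type \<open>complex^'n^'n\<close> in the library are entrywise, so the
  powers with respect to the matrix product are iterated explicitly. The series converges in
  the norm of \<open>complex^'n^'n\<close>.\<close>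

definition mat_exp :: "complex^'n^'n \<Rightarrow> complex^'n^'n" where
  "mat_exp A = (\<Sum>k. (1 / fact k) *\<^sub>R (((**) A ^^ k) (mat 1)))"

section \<open>Matrix weights and their matrix valued inner product\<close>

text \<open>A weight on the whole real line. As a weight is only determined up to Lebesgue null sets,
  positive definiteness is required almost everywhere.\<close>

definition matrix_weight :: "(real \<Rightarrow> complex^'n^'n) \<Rightarrow> bool" where
  "matrix_weight W \<longleftrightarrow>
     (AE x in lebesgue. pos_def (W x)) \<and> (\<forall>k. integrable lebesgue (\<lambda>x. x ^ k *\<^sub>R W x))"

definition weight_inner ::
  "(real \<Rightarrow> complex^'n^'n) \<Rightarrow> (real \<Rightarrow> complex^'n^'n) \<Rightarrow> (real \<Rightarrow> complex^'n^'n) \<Rightarrow> complex^'n^'n"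
where
  "weight_inner W H G = (LINT y|lebesgue. H y ** W y ** cadjoint (G y))"

section \<open>Matrix polynomials and monic orthogonal polynomials\<close>

text \<open>Matrix valued polynomials are matrices of polynomials.\<close>

type_synonym 'n mat_poly = "complex poly^'n^'n"

definition eval_mat_poly :: "('n::finite) mat_poly \<Rightarrow> real \<Rightarrow> complex^'n^'n" where
  "eval_mat_poly F x = map_matrix (\<lambda>p. poly p (complex_of_real x)) F"

definition coeff_mat_poly :: "('n::finite) mat_poly \<Rightarrow> nat \<Rightarrow> complex^'n^'n" where
  "coeff_mat_poly F k = map_matrix (\<lambda>p. coeff p k) F"

definition monic_of_degree :: "('n::finite) mat_poly \<Rightarrow> nat \<Rightarrow> bool" where
  "monic_of_degree F n \<longleftrightarrow> coeff_mat_poly F n = mat 1 \<and> (\<forall>k>n. coeff_mat_poly F k = 0)"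

definition sq_norm_seq :: "(real \<Rightarrow> complex^'n^'n) \<Rightarrow> (nat \<Rightarrow> ('n::finite) mat_poly) \<Rightarrow> nat \<Rightarrow> complex^'n^'n" where
  "sq_norm_seq W P n = weight_inner W (eval_mat_poly (P n)) (eval_mat_poly (P n))"

definition monic_orthogonal :: "(real \<Rightarrow> complex^'n^'n) \<Rightarrow> (nat \<Rightarrow> ('n::finite) mat_poly) \<Rightarrow> bool" where
  "monic_orthogonal W P \<longleftrightarrow>
     (\<forall>n. monic_of_degree (P n) n) \<and>
     (\<forall>n m. weight_inner W (eval_mat_poly (P n)) (eval_mat_poly (P m)) =
        (if n = m then sq_norm_seq W P n else 0))"

section \<open>Differential operators with rational coefficients, acting from the right\<close>

type_synonym 'n mat_rat = "complex poly fract^'n^'n"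

definition rat_of_mat_poly :: "('n::finite) mat_poly \<Rightarrow> 'n mat_rat" where
  "rat_of_mat_poly F = map_matrix to_fract F"

definition const_mat :: "complex^'n^'n \<Rightarrow> ('n::finite) mat_poly" where
  "const_mat A = map_matrix (\<lambda>z. [:z:]) A"

text \<open>Value of a rational function, computed from its reduced fraction; at the finitely many
  poles the value is 0 by convention, which is invisible to integrals.\<close>

definition eval_rat :: "complex poly fract \<Rightarrow> complex \<Rightarrow> complex" where
  "eval_rat r z = poly (fst (quot_of_fract r)) z / poly (snd (quot_of_fract r)) z"

definition eval_mat_rat :: "('n::finite) mat_rat \<Rightarrow> real \<Rightarrow> complex^'n^'n" where
  "eval_mat_rat F x = map_matrix (\<lambda>r. eval_rat r (complex_of_real x)) F"

text \<open>The operator with coefficients \<open>F\<^sub>0, F\<^sub>1, \<dots>, F\<^sub>d\<close> at \<open>1, \<partial>\<^sub>x, \<dots>, \<partial>\<^sub>x\<^sup>d\<close> is the formal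
  polynomial \<open>[:F\<^sub>0, F\<^sub>1, \<dots>, F\<^sub>d:]\<close> in \<open>\<partial>\<^sub>x\<close>. Only the additive structure of the type is used;
  its multiplication is not the composition of operators.\<close>

type_synonym 'n diff_op = "'n mat_rat poly"

definition act :: "('n::finite) mat_poly \<Rightarrow> 'n diff_op \<Rightarrow> 'n mat_rat" where
  "act F D = (\<Sum>j\<le>degree D. rat_of_mat_poly ((map_matrix pderiv ^^ j) F) ** coeff D j)"

text \<open>For rational coefficients the two pairings need not exist; their existence is part of the
  definition. It is automatic when all coefficients are polynomials and \<open>W\<close> is a matrix weight.\<close>

definition is_adjoint :: "(real \<Rightarrow> complex^'n^'n) \<Rightarrow> ('n::finite) diff_op \<Rightarrow> 'n diff_op \<Rightarrow> bool" where
  "is_adjoint W D E \<longleftrightarrow> (\<forall>F G.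
     integrable lebesgue
       (\<lambda>y. eval_mat_rat (act F D) y ** W y ** cadjoint (eval_mat_poly G y)) \<and>
     integrable lebesgue
       (\<lambda>y. eval_mat_poly F y ** W y ** cadjoint (eval_mat_rat (act G E) y)) \<and>
     weight_inner W (eval_mat_rat (act F D)) (eval_mat_poly G) =
       weight_inner W (eval_mat_poly F) (eval_mat_rat (act G E)))"

text \<open>The operators for which \<open>P\<close> is an eigenfunction up to a difference operator in \<open>n\<close>,
  with coefficient sequences \<open>A j\<close> for \<open>-l \<le> j \<le> m\<close>.\<close>

definition right_fourier :: "(nat \<Rightarrow> ('n::finite) mat_poly) \<Rightarrow> 'n diff_op set" where
  "right_fourier P = {D. \<exists>(l::nat) (m::nat) (A :: int \<Rightarrow> nat \<Rightarrow> complex^'n^'n). \<forall>n.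
     act (P n) D = rat_of_mat_poly
       (\<Sum>j\<in>{- int l..int m}. const_mat (A j n) **
          (if 0 \<le> int n + j then P (nat (int n + j)) else 0))}"

section \<open>The Hermite-type weight\<close>

definition hermite_weight :: "complex^'n^'n \<Rightarrow> real \<Rightarrow> real \<Rightarrow> complex^'n^'n" where
  "hermite_weight A t x =
     exp (- (x ^ 2) - x * t) *\<^sub>R (mat_exp (x *\<^sub>R A) ** mat_exp (x *\<^sub>R cadjoint A))"

end

theory Submission
  imports Defs "HOL-Probability.Probability" "HOL-Real_Asymp.Real_Asymp"
begin

text \<open>
  The adjoint condition is the weak form of the matrix differential equation
  \<open>W' = A W + W A\<^sup>* - (2 x + t) W\<close>, which the Hermite-type weight \<open>V\<close> solves. Tested against
  \<open>x\<^sup>k I\<close> and \<open>I\<close> it becomes a recursion in which the moment of order \<open>k + 1\<close> is determined by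
  those of order \<open>k\<close> and \<open>k - 1\<close> (\<open>adjoint_moment_recursion\<close>). Integration by parts gives the
  same recursion for \<open>V\<close> (\<open>hermite_moment_recursion\<close>). The moments of order zero agree by
  hypothesis, so all matrix moments of the two weights agree.

  The moment problem of \<open>V\<close> is determinate, since \<open>V\<close> has Gaussian decay up to a factor
  \<open>e\<^bsup>c |x|\<^esup>\<close>. The determinacy is used in the following form. The trace of the given weight is
  nonnegative and has the moments of the trace of \<open>V\<close>, so it is integrable against every
  \<open>e\<^bsup>c |x|\<^esup>\<close> (\<open>exp_integrable_if_moments_eq\<close>). A positive definite matrix is dominated entrywise by
  its trace (\<open>pos_def_norm_entry_le_trace\<close>), so all entries of the given weight inherit this
  decay. The real and imaginary parts of the entries of the difference of the weights are then
  functions with exponential decay and vanishing moments. Their Fourier transforms vanish, by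
  expanding the exponential, and they are zero almost everywhere by the uniqueness theorem for
  characteristic functions (\<open>AE_zero_if_moments_zero\<close>).

  Hence the two weights coincide almost everywhere, and the identity matrix serves as \<open>K\<close>.
\<close>

section \<open>Functions determined by their moments\<close>

text \<open>The uniqueness theorem for characteristic functions, transferred from probability measures to
  signed densities. The positive and the negative part of \<open>f\<close> have the same mass \<open>m\<close> (frequency
  zero); if \<open>m > 0\<close>, both are densities of probability measures after division by \<open>m\<close>.\<close>
lemma AE_zero_if_fourier_zero:
  fixes f :: "real \<Rightarrow> real"
  assumes int: "integrable lborel f"
    and fourier: "\<And>s. (CLINT x|lborel. f x *\<^sub>R iexp (s * x)) = 0"
  shows "AE x in lborel. f x = 0"
proof -
  define p where "p = (\<lambda>x. max 0 (f x))"
  define q where "q = (\<lambda>x. max 0 (- f x))"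
  have pq: "f x = p x - q x" "0 \<le> p x" "0 \<le> q x" for x
    by (auto simp: p_def q_def)
  have intp: "integrable lborel p" and intq: "integrable lborel q"
    using int by (auto simp: p_def q_def intro!: integrable_max)
  have iexp_int: "integrable lborel (\<lambda>x. g x *\<^sub>R iexp (s * x))"
    if "integrable lborel g" for g :: "real \<Rightarrow> real" and s
    by (rule Bochner_Integration.integrable_bound[OF that]) (use that in auto)
  have eq: "(CLINT x|lborel. p x *\<^sub>R iexp (s * x)) = (CLINT x|lborel. q x *\<^sub>R iexp (s * x))" for s
  proof -
    have "(CLINT x|lborel. f x *\<^sub>R iexp (s * x))
        = (CLINT x|lborel. p x *\<^sub>R iexp (s * x)) - (CLINT x|lborel. q x *\<^sub>R iexp (s * x))"
      unfolding pq(1) scaleR_diff_left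
      by (rule Bochner_Integration.integral_diff) (use iexp_int intp intq in auto)
    with fourier show ?thesis by simp
  qed
  define m where "m = (LINT x|lborel. p x)"
  have m_q: "m = (LINT x|lborel. q x)"
  proof -
    have "complex_of_real (LINT x|lborel. p x) = complex_of_real (LINT x|lborel. q x)"
      using eq[of 0] by (simp add: scaleR_conv_of_real)
    then show ?thesis unfolding m_def by (simp only: of_real_eq_iff)
  qed
  have "m \<ge> 0" unfolding m_def by (rule integral_nonneg_AE) (use pq in auto)
  then consider "m = 0" | "m > 0" by linarith
  then show ?thesis
  proof cases
    case 1
    have "AE x in lborel. p x = 0"
      using integral_nonneg_eq_0_iff_AE[OF intp] pq 1 m_def by simp
    moreover have "AE x in lborel. q x = 0"
      using integral_nonneg_eq_0_iff_AE[OF intq] pq 1 m_q by simp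
    ultimately show ?thesis by eventually_elim (simp add: pq)
  next
    case 2
    define \<mu> where "\<mu> g = density lborel (\<lambda>x. ennreal (g x / m))" for g :: "real \<Rightarrow> real"
    have dist: "real_distribution (\<mu> g)"
      if "integrable lborel g" "\<And>x. 0 \<le> g x" "(LINT x|lborel. g x) = m" for g
    proof -
      have "emeasure (\<mu> g) (space (\<mu> g)) = (\<integral>\<^sup>+x. ennreal (g x / m) \<partial>lborel)"
        unfolding \<mu>_def using that(1) by (simp add: emeasure_density)
      also have "\<dots> = ennreal (LINT x|lborel. g x / m)"
        by (rule nn_integral_eq_integral) (use that 2 in auto)
      also have "\<dots> = 1" using that 2 by simp
      finally have "prob_space (\<mu> g)" by (rule prob_spaceI)
      then show ?thesis
        by (simp add: real_distribution_def real_distribution_axioms_def \<mu>_def)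
    qed
    have char: "char (\<mu> g) s = (CLINT x|lborel. g x *\<^sub>R iexp (s * x)) / m"
      if "integrable lborel g" "\<And>x. 0 \<le> g x" for g s
    proof -
      have "char (\<mu> g) s = (CLINT x|lborel. (g x / m) *\<^sub>R iexp (s * x))"
        unfolding char_def \<mu>_def by (rule integral_density) (use that 2 in auto)
      also have "\<dots> = (CLINT x|lborel. (g x *\<^sub>R iexp (s * x)) / complex_of_real m)"
        by (simp add: scaleR_conv_of_real)
      finally show ?thesis by simp
    qed
    have "\<mu> p = \<mu> q"
    proof (rule Levy_uniqueness)
      show "real_distribution (\<mu> p)" by (rule dist) (use intp pq m_def in auto)
      show "real_distribution (\<mu> q)" by (rule dist) (use intq pq m_q in auto)
      show "char (\<mu> p) = char (\<mu> q)"
        by (rule ext) (simp only: char[OF intp pq(2)] char[OF intq pq(3)] eq)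
    qed
    then have "AE x in lborel. ennreal (p x / m) = ennreal (q x / m)"
      unfolding \<mu>_def
      by (intro sigma_finite_measure.density_unique)
        (use intp intq sigma_finite_lborel in auto)
    then show ?thesis
      by eventually_elim (use pq 2 in \<open>auto simp: divide_simps\<close>)
  qed
qed

lemma abs_exp_partial_sum_le:
  fixes y :: real
  shows "(\<Sum>k<n. \<bar>y\<bar> ^ k / fact k) \<le> exp \<bar>y\<bar>"
proof -
  have "(\<lambda>k. \<bar>y\<bar> ^ k /\<^sub>R fact k) sums exp \<bar>y\<bar>" by (rule exp_converges)
  then have s: "(\<lambda>k. \<bar>y\<bar> ^ k / fact k) sums exp \<bar>y\<bar>"
    by (simp add: divide_inverse mult.commute)
  show ?thesis unfolding sums_unique[OF s]
    by (rule sum_le_suminf) (use s in \<open>auto simp: sums_iff\<close>)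
qed

lemma power_le_fact_exp_abs: "\<bar>x :: real\<bar> ^ k \<le> fact k * exp \<bar>x\<bar>"
proof -
  have "\<bar>x\<bar> ^ k / fact k \<le> (\<Sum>j<Suc k. \<bar>x\<bar> ^ j / fact j)"
    by (rule member_le_sum) auto
  also have "\<dots> \<le> exp \<bar>x\<bar>" by (rule abs_exp_partial_sum_le)
  finally show ?thesis by (simp add: divide_simps mult.commute)
qed

text \<open>Under the decay hypothesis the Fourier transform may be expanded into its Taylor series under
  the integral sign, and each term is a multiple of a moment.\<close>
lemma AE_zero_if_moments_zero:
  fixes f :: "real \<Rightarrow> real"
  assumes meas: "f \<in> borel_measurable lborel"
    and exp_int: "\<And>c. integrable lborel (\<lambda>x. exp \<bar>c * x\<bar> * f x)"
    and moments: "\<And>k. (LINT x|lborel. x ^ k * f x) = 0"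
  shows "AE x in lborel. f x = 0"
proof (rule AE_zero_if_fourier_zero)
  show int: "integrable lborel f" using exp_int[of 0] by simp
  fix s :: real
  \<comment> \<open>the Taylor polynomials of the integrand, dominated by \<open>exp \<bar>s x\<bar> \<bar>f x\<bar>\<close>\<close>
  define S where "S n x = (\<Sum>k<n. ((\<i> * s) ^ k / fact k) * complex_of_real (x ^ k * f x))"
    for n x
  have mom_int: "integrable lborel (\<lambda>x. x ^ k * f x)" for k
  proof (rule Bochner_Integration.integrable_bound)
    show "integrable lborel (\<lambda>x. fact k * (exp \<bar>1 * x\<bar> * f x))"
      using exp_int[of 1] by (intro integrable_mult_right) auto
    show "AE x in lborel. norm (x ^ k * f x) \<le> norm (fact k * (exp \<bar>1 * x\<bar> * f x))"
    proof (rule AE_I2)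
      fix x :: real
      have "\<bar>x\<bar> ^ k * \<bar>f x\<bar> \<le> fact k * exp \<bar>x\<bar> * \<bar>f x\<bar>"
        by (intro mult_right_mono power_le_fact_exp_abs) auto
      then show "norm (x ^ k * f x) \<le> norm (fact k * (exp \<bar>1 * x\<bar> * f x))"
        by (simp add: abs_mult power_abs mult.assoc)
    qed
  qed (use meas in auto)
  have zero: "(CLINT x|lborel. S n x) = 0" for n
  proof -
    have "(CLINT x|lborel. S n x)
        = (\<Sum>k<n. CLINT x|lborel. ((\<i> * s) ^ k / fact k) * complex_of_real (x ^ k * f x))"
      unfolding S_def
      by (rule Bochner_Integration.integral_sum)
        (intro integrable_mult_right integrable_of_real mom_int)
    also have "\<dots> = 0"
      by (simp only: integral_mult_right_zero integral_complex_of_real moments) simp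
    finally show ?thesis .
  qed
  have lim: "(\<lambda>n. CLINT x|lborel. S n x) \<longlonglongrightarrow> (CLINT x|lborel. f x *\<^sub>R iexp (s * x))"
  proof (rule integral_dominated_convergence)
    show "integrable lborel (\<lambda>x. norm (exp \<bar>s * x\<bar> * f x))"
      by (intro integrable_norm exp_int)
    show "AE x in lborel. (\<lambda>n. S n x) \<longlonglongrightarrow> f x *\<^sub>R iexp (s * x)"
    proof (rule AE_I2)
      fix x
      have "(\<lambda>k. (\<i> * (s * x)) ^ k /\<^sub>R fact k) sums iexp (s * x)" by (rule exp_converges)
      then have "(\<lambda>k. f x *\<^sub>R ((\<i> * (s * x)) ^ k /\<^sub>R fact k)) sums (f x *\<^sub>R iexp (s * x))"
        by (rule sums_scaleR_right)
      moreover have "f x *\<^sub>R ((\<i> * (s * x)) ^ k /\<^sub>R fact k)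
          = ((\<i> * s) ^ k / fact k) * complex_of_real (x ^ k * f x)" for k
        by (simp add: scaleR_conv_of_real field_simps power_mult_distrib)
      ultimately show "(\<lambda>n. S n x) \<longlonglongrightarrow> f x *\<^sub>R iexp (s * x)"
        unfolding S_def by (simp add: sums_def)
    qed
    show "AE x in lborel. norm (S n x) \<le> norm (exp \<bar>s * x\<bar> * f x)" for n
    proof (rule AE_I2)
      fix x
      have "norm (S n x) \<le> (\<Sum>k<n. norm (((\<i> * s) ^ k / fact k) * complex_of_real (x ^ k * f x)))"
        unfolding S_def by (rule norm_sum)
      also have "\<dots> = (\<Sum>k<n. \<bar>s * x\<bar> ^ k / fact k) * \<bar>f x\<bar>"
        unfolding sum_distrib_right
        by (intro sum.cong refl)
          (simp add: norm_mult norm_power norm_divide abs_mult power_mult_distrib power_abs)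
      also have "\<dots> \<le> exp \<bar>s * x\<bar> * \<bar>f x\<bar>"
        by (intro mult_right_mono abs_exp_partial_sum_le) auto
      finally show "norm (S n x) \<le> norm (exp \<bar>s * x\<bar> * f x)" by (simp add: abs_mult)
    qed
  qed (use meas in \<open>auto simp: S_def\<close>)
  then show "(CLINT x|lborel. f x *\<^sub>R iexp (s * x)) = 0"
    unfolding zero by (rule LIMSEQ_unique[OF _ tendsto_const])
qed

lemma lebesgue_AE_zero_if_moments_zero:
  fixes f :: "real \<Rightarrow> real"
  assumes exp_int: "\<And>c. integrable lebesgue (\<lambda>x. exp \<bar>c * x\<bar> * f x)"
    and moments: "\<And>k. (LINT x|lebesgue. x ^ k * f x) = 0"
  shows "AE x in lebesgue. f x = 0"
proof -
  have "f \<in> borel_measurable lebesgue" using exp_int[of 0] by auto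
  then obtain g where g: "g \<in> borel_measurable lborel" and fg: "AE x in lborel. f x = g x"
    using completion_ex_borel_measurable_real by blast
  then have fg': "AE x in lebesgue. f x = g x" by (simp add: AE_completion_iff)
  have [measurable]: "g \<in> borel_measurable lborel" by fact
  have [measurable]: "f \<in> borel_measurable lebesgue" by fact
  have [measurable]: "(\<lambda>x. exp \<bar>c * x\<bar> * g x) \<in> borel_measurable lebesgue"
    "(\<lambda>x. x ^ k * g x) \<in> borel_measurable lebesgue"
    "(\<lambda>x :: real. x ^ k) \<in> borel_measurable lebesgue" for c k
    by (rule measurable_completion, measurable)+
  have "AE x in lborel. g x = 0"
  proof (rule AE_zero_if_moments_zero[OF g])
    fix c
    have "integrable lebesgue (\<lambda>x. exp \<bar>c * x\<bar> * g x)"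
      by (rule integrable_cong_AE_imp[OF exp_int[of c]]) (use fg' in \<open>auto\<close>)
    then show "integrable lborel (\<lambda>x. exp \<bar>c * x\<bar> * g x)"
      by (subst (asm) integrable_completion) auto
  next
    fix k
    have "(LINT x|lebesgue. x ^ k * g x) = (LINT x|lebesgue. x ^ k * f x)"
      by (rule integral_cong_AE) (use fg' in auto)
    then show "(LINT x|lborel. x ^ k * g x) = 0"
      by (subst (asm) integral_completion) (auto simp: moments)
  qed
  then have "AE x in lborel. f x = 0" using fg by eventually_elim simp
  then show ?thesis by (simp add: AE_completion_iff)
qed

text \<open>The partial sums of the Taylor series of \<open>cosh (c x)\<close> involve only even powers, so they increase
  when multiplied with \<open>w\<close>. Their integrals depend on the moments alone and are thus the same for
  \<open>v\<close>, where they converge by dominated convergence. Monotone convergence then applies to \<open>w\<close>.\<close>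
lemma exp_integrable_if_moments_eq:
  fixes v w :: "real \<Rightarrow> real"
  assumes nonneg: "AE x in lebesgue. 0 \<le> w x"
    and mom_w: "\<And>k. integrable lebesgue (\<lambda>x. x ^ k * w x)"
    and mom_v: "\<And>k. integrable lebesgue (\<lambda>x. x ^ k * v x)"
    and exp_v: "\<And>c. integrable lebesgue (\<lambda>x. exp \<bar>c * x\<bar> * v x)"
    and eq: "\<And>k. (LINT x|lebesgue. x ^ k * w x) = (LINT x|lebesgue. x ^ k * v x)"
  shows "integrable lebesgue (\<lambda>x. exp \<bar>c * x\<bar> * w x)"
proof -
  have [measurable]: "w \<in> borel_measurable lebesgue" "v \<in> borel_measurable lebesgue"
    using mom_w[of 0] mom_v[of 0] by auto
  have [measurable]: "(\<lambda>x. cosh (c * x)) \<in> borel_measurable lebesgue"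
    "(\<lambda>x. exp \<bar>c * x\<bar>) \<in> borel_measurable lebesgue"
    by (rule measurable_completion, simp add: cosh_def)+
  define a :: "nat \<Rightarrow> real" where "a k = (if even k then c ^ k / fact k else 0)" for k
  have a: "a k * x ^ k = (if even k then (c * x) ^ k / fact k else 0)" for k x
    by (simp add: a_def power_mult_distrib)
  have a_sums: "(\<lambda>k. a k * x ^ k) sums cosh (c * x)" for x
    unfolding a using cosh_converges[of "c * x"] by (simp add: divide_inverse mult.commute cong: if_cong)
  have a_nonneg: "0 \<le> a k * x ^ k" for k x
    unfolding a by (auto simp: zero_le_even_power)
  have a_le: "a k * x ^ k \<le> \<bar>c * x\<bar> ^ k / fact k" for k x
    unfolding a by (auto simp: power_even_abs divide_right_mono)
  define S where "S u n x = (\<Sum>k<n. a k * x ^ k) * u x" for u :: "real \<Rightarrow> real" and n x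
  have S_eq: "S u n = (\<lambda>x. \<Sum>k<n. a k * (x ^ k * u x))" for u n
    by (rule ext) (simp add: S_def sum_distrib_right mult.assoc)
  have S_int: "integrable lebesgue (S u n)"
    and S_integral: "(LINT x|lebesgue. S u n x) = (\<Sum>k<n. a k * (LINT x|lebesgue. x ^ k * u x))"
    if "\<And>k. integrable lebesgue (\<lambda>x. x ^ k * u x)" for u n
    unfolding S_eq using that by (auto intro!: Bochner_Integration.integrable_sum)
  have "(\<lambda>n. LINT x|lebesgue. S v n x) \<longlonglongrightarrow> (LINT x|lebesgue. cosh (c * x) * v x)"
  proof (rule integral_dominated_convergence)
    show "integrable lebesgue (\<lambda>x. norm (exp \<bar>c * x\<bar> * v x))"
      by (intro integrable_norm exp_v)
    show "S v n \<in> borel_measurable lebesgue" for n using S_int[OF mom_v] by auto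
    show "AE x in lebesgue. (\<lambda>n. S v n x) \<longlonglongrightarrow> cosh (c * x) * v x"
      unfolding S_def using a_sums by (intro AE_I2 tendsto_mult tendsto_const) (simp add: sums_def)
    show "AE x in lebesgue. norm (S v n x) \<le> norm (exp \<bar>c * x\<bar> * v x)" for n
    proof (rule AE_I2)
      fix x
      have "(\<Sum>k<n. a k * x ^ k) \<le> (\<Sum>k<n. \<bar>c * x\<bar> ^ k / fact k)"
        by (rule sum_mono) (rule a_le)
      also have "\<dots> \<le> exp \<bar>c * x\<bar>" by (rule abs_exp_partial_sum_le)
      finally have "\<bar>\<Sum>k<n. a k * x ^ k\<bar> \<le> exp \<bar>c * x\<bar>"
        using sum_nonneg[of "{..<n}" "\<lambda>k. a k * x ^ k"] a_nonneg by auto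
      then show "norm (S v n x) \<le> norm (exp \<bar>c * x\<bar> * v x)"
        unfolding S_def by (auto simp: abs_mult intro!: mult_right_mono)
    qed
  qed measurable
  moreover have "(LINT x|lebesgue. S v n x) = (LINT x|lebesgue. S w n x)" for n
    by (simp add: S_integral mom_v mom_w eq)
  ultimately have lim: "(\<lambda>n. LINT x|lebesgue. S w n x) \<longlonglongrightarrow> (LINT x|lebesgue. cosh (c * x) * v x)"
    by simp
  have "integrable lebesgue (\<lambda>x. cosh (c * x) * w x)"
  proof (rule integrable_monotone_convergence[OF _ _ _ lim])
    show "integrable lebesgue (S w n)" for n by (rule S_int[OF mom_w])
    show "AE x in lebesgue. mono (\<lambda>n. S w n x)"
      using nonneg
    proof eventually_elim
      case (elim x)
      then show ?case unfolding S_def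
        by (intro monoI mult_right_mono sum_mono2) (use a_nonneg in auto)
    qed
    show "AE x in lebesgue. (\<lambda>n. S w n x) \<longlonglongrightarrow> cosh (c * x) * w x"
      unfolding S_def using a_sums by (intro AE_I2 tendsto_mult tendsto_const) (simp add: sums_def)
  qed measurable
  then have "integrable lebesgue (\<lambda>x. 2 * (cosh (c * x) * w x))" by (rule integrable_mult_right)
  then show ?thesis
  proof (rule Bochner_Integration.integrable_bound)
    show "AE x in lebesgue. norm (exp \<bar>c * x\<bar> * w x) \<le> norm (2 * (cosh (c * x) * w x))"
    proof (rule AE_I2)
      fix x
      have "exp \<bar>c * x\<bar> \<le> 2 * cosh (c * x)" 
        by (simp add: cosh_def abs_if)
      then have "exp \<bar>c * x\<bar> * \<bar>w x\<bar> \<le> 2 * cosh (c * x) * \<bar>w x\<bar>"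
        by (intro mult_right_mono) auto
      then show "norm (exp \<bar>c * x\<bar> * w x) \<le> norm (2 * (cosh (c * x) * w x))"
        by (simp add: abs_mult mult.assoc cosh_real_nonneg)
    qed
  qed auto
qed

text \<open>Half of the exponent is spent on absorbing the linear term by completing the square.\<close>
lemma integrable_gaussian_exp:
  "integrable lborel (\<lambda>x::real. exp (- (x ^ 2) + c * \<bar>x\<bar>))"
proof (rule Bochner_Integration.integrable_bound)
  show "integrable lborel (\<lambda>x::real. exp (c ^ 2 / 2) * sqrt (2 * pi) * (std_normal_density x * x ^ 0))"
    by (intro integrable_mult_right integrable_std_normal_moment)
  show "AE x in lborel. norm (exp (- (x ^ 2) + c * \<bar>x\<bar>))
      \<le> norm (exp (c ^ 2 / 2) * sqrt (2 * pi) * (std_normal_density x * x ^ 0))"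
  proof (rule AE_I2)
    fix x :: real
    have "0 \<le> (c - \<bar>x\<bar>) ^ 2" by simp
    then have "- (x ^ 2) + c * \<bar>x\<bar> \<le> c ^ 2 / 2 + - (x ^ 2) / 2"
      by (simp add: power2_eq_square algebra_simps)
    then have "exp (- (x ^ 2) + c * \<bar>x\<bar>) \<le> exp (c ^ 2 / 2) * exp (- (x ^ 2) / 2)"
      unfolding exp_add[symmetric] by simp
    then show "norm (exp (- (x ^ 2) + c * \<bar>x\<bar>))
      \<le> norm (exp (c ^ 2 / 2) * sqrt (2 * pi) * (std_normal_density x * x ^ 0))"
      by (simp add: std_normal_density_def)
  qed
qed auto

section \<open>The matrix exponential\<close>

text \<open>The type of matrices carries the entrywise multiplication, so facts on normed algebras say
  nothing about the matrix product. Norm estimates, derivatives and integrals of matrix products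
  are obtained from bounded bilinearity instead.\<close>
lemma bounded_bilinear_matrix_mult:
  "bounded_bilinear ((**) :: complex^'n^'n \<Rightarrow> complex^'n^'n \<Rightarrow> complex^'n^'n)"
  unfolding bilinear_conv_bounded_bilinear[symmetric] bilinear_def
  by (auto intro!: linearI
      simp: vec_eq_iff matrix_matrix_mult_def algebra_simps sum.distrib scaleR_sum_right)

lemma bounded_linear_entry: "bounded_linear (\<lambda>X :: complex^'n^'n. X $ i $ j)"
  by (intro bounded_linear_compose[OF bounded_linear_vec_nth] bounded_linear_vec_nth)

interpretation mm: bounded_bilinear "(**) :: complex^'n^'n \<Rightarrow> complex^'n^'n \<Rightarrow> complex^'n^'n"
  by (rule bounded_bilinear_matrix_mult)

definition mat_pow :: "complex^'n^'n \<Rightarrow> nat \<Rightarrow> complex^'n^'n" where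
  "mat_pow A k = ((**) A ^^ k) (mat 1)"

lemma mat_pow_simps: "mat_pow A 0 = mat 1" "mat_pow A (Suc k) = A ** mat_pow A k"
  by (simp_all add: mat_pow_def)

lemma mat_pow_commute: "A ** mat_pow A k = mat_pow A k ** A"
proof (induction k)
  case (Suc k)
  have "A ** mat_pow A (Suc k) = A ** (mat_pow A k ** A)" by (simp add: mat_pow_simps Suc)
  then show ?case by (simp add: mat_pow_simps matrix_mul_assoc)
qed (simp add: mat_pow_simps)

lemma mat_pow_scaleR: "mat_pow (x *\<^sub>R A) k = x ^ k *\<^sub>R mat_pow A k"
  by (induction k) (simp_all add: mat_pow_simps mm.scaleR_left mm.scaleR_right)

text \<open>Bounded bilinearity gives \<open>norm (A ** B) \<le> norm A * norm B * K\<close>, so \<open>c = norm A * K\<close> works. The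
  factor \<open>norm (mat 1)\<close> stems from the zeroth power; it is not 1 in dimension greater than 1.\<close>
lemma norm_mat_pow_le:
  fixes A :: "complex^'n^'n"
  shows "\<exists>c. \<forall>k. norm (mat_pow A k) \<le> norm (mat 1 :: complex^'n^'n) * c ^ k"
proof -
  obtain K where K: "K \<ge> 0" "\<And>B C :: complex^'n^'n. norm ((B :: complex^'n^'n) ** C) \<le> norm B * norm C * K"
    using mm.nonneg_bounded by blast
  have "norm (mat_pow A k) \<le> norm (mat 1 :: complex^'n^'n) * (norm A * K) ^ k" for k
  proof (induction k)
    case (Suc k)
    have "norm (mat_pow A (Suc k)) \<le> norm A * norm (mat_pow A k) * K"
      unfolding mat_pow_simps by (rule K)
    also have "\<dots> = (norm A * K) * norm (mat_pow A k)" by simp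
    also have "\<dots> \<le> (norm A * K) * (norm (mat 1 :: complex^'n^'n) * (norm A * K) ^ k)"
      using Suc K(1) by (intro mult_left_mono) auto
    finally show ?case by (simp add: mult_ac)
  qed (simp add: mat_pow_simps)
  then show ?thesis by blast
qed

lemma mat_exp_scaleR_eq: "mat_exp (x *\<^sub>R A) = (\<Sum>k. (x ^ k / fact k) *\<^sub>R mat_pow A k)"
  unfolding mat_exp_def mat_pow_def[symmetric] mat_pow_scaleR by simp

lemma summable_mat_exp: "summable (\<lambda>k. (x ^ k / fact k) *\<^sub>R mat_pow A k)"
  and norm_mat_exp_le: "\<exists>c. \<forall>x. norm (mat_exp (x *\<^sub>R A)) \<le> norm (mat 1 :: complex^'n^'n) * exp (c * \<bar>x\<bar>)"
  for A :: "complex^'n^'n"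
proof -
  let ?M = "norm (mat 1 :: complex^'n^'n)"
  obtain c where c: "\<And>k. norm (mat_pow A k) \<le> ?M * c ^ k"
    using norm_mat_pow_le[of A] by blast
  have s: "(\<lambda>k. ?M * ((c * \<bar>x\<bar>) ^ k / fact k)) sums (?M * exp (c * \<bar>x\<bar>))" for x
    using sums_mult[OF exp_converges[of "c * \<bar>x\<bar>"], of ?M] by (simp add: divide_inverse mult_ac)
  have b: "norm ((x ^ k / fact k) *\<^sub>R mat_pow A k) \<le> ?M * ((c * \<bar>x\<bar>) ^ k / fact k)" for x k
  proof -
    have "norm ((x ^ k / fact k) *\<^sub>R mat_pow A k) = \<bar>x\<bar> ^ k / fact k * norm (mat_pow A k)"
      by (simp add: power_abs)
    also have "\<dots> \<le> \<bar>x\<bar> ^ k / fact k * (?M * c ^ k)"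
      by (intro mult_left_mono c) auto
    finally show ?thesis by (simp add: power_mult_distrib mult_ac)
  qed
  show sm: "summable (\<lambda>k. (x ^ k / fact k) *\<^sub>R mat_pow A k)" for x
    by (rule summable_comparison_test'[OF sums_summable[OF s] b])
  have "norm (mat_exp (x *\<^sub>R A)) \<le> ?M * exp (c * \<bar>x\<bar>)" for x
    unfolding mat_exp_scaleR_eq using b s
    by (rule norm_sums_le[OF summable_sums[OF sm], rotated])
  then show "\<exists>c. \<forall>x. norm (mat_exp (x *\<^sub>R A)) \<le> ?M * exp (c * \<bar>x\<bar>)"
    by blast
qed

text \<open>Each entry is a scalar power series, which gives access to termwise differentiation.\<close>
lemma mat_exp_entry:
  fixes A :: "complex^'n^'n"
  shows "(\<lambda>k. (mat_pow A k $ i $ j / fact k) * complex_of_real x ^ k) sums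
    (mat_exp (x *\<^sub>R A) $ i $ j)"
proof -
  from bounded_linear.sums[OF bounded_linear_entry summable_sums[OF summable_mat_exp]]
  show ?thesis
    unfolding mat_exp_scaleR_eq[symmetric] vector_scaleR_component
    by (simp add: scaleR_conv_of_real mult_ac)
qed

lemma has_vector_derivative_matrix:
  fixes F :: "real \<Rightarrow> complex^'n^'n"
  assumes "\<And>i j. ((\<lambda>x. F x $ i $ j) has_vector_derivative D $ i $ j) (at x)"
  shows "(F has_vector_derivative D) (at x)"
  unfolding has_vector_derivative_def has_derivative_def
proof (intro conjI vec_tendstoI)
  show "bounded_linear (\<lambda>h. h *\<^sub>R D)" by (rule bounded_linear_scaleR_left)
  fix i j
  show "((\<lambda>y. ((F y - F (netlimit (at x)) - (y - netlimit (at x)) *\<^sub>R D) /\<^sub>R norm (y - netlimit (at x))) $ i $ j)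
    \<longlongrightarrow> 0 $ i $ j) (at x)"
    using assms[of i j] unfolding has_vector_derivative_def has_derivative_def by simp
qed

lemma mat_exp_derivative:
  fixes A :: "complex^'n^'n"
  shows mat_exp_has_vector_derivative:
      "((\<lambda>x. mat_exp (x *\<^sub>R A)) has_vector_derivative A ** mat_exp (x *\<^sub>R A)) (at x)"
    and mat_exp_commute: "A ** mat_exp (x *\<^sub>R A) = mat_exp (x *\<^sub>R A) ** A"
proof -
  note sm = summable_mat_exp[of _ A]
  have "A ** mat_exp (x *\<^sub>R A) = (\<Sum>k. A ** ((x ^ k / fact k) *\<^sub>R mat_pow A k))"
    unfolding mat_exp_scaleR_eq by (rule bounded_linear.suminf[OF mm.bounded_linear_right sm])
  also have "\<dots> = (\<Sum>k. ((x ^ k / fact k) *\<^sub>R mat_pow A k) ** A)"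
    by (simp add: mm.scaleR_left mm.scaleR_right mat_pow_commute)
  also have "\<dots> = mat_exp (x *\<^sub>R A) ** A"
    unfolding mat_exp_scaleR_eq
    by (rule bounded_linear.suminf[OF mm.bounded_linear_left sm, symmetric])
  finally show "A ** mat_exp (x *\<^sub>R A) = mat_exp (x *\<^sub>R A) ** A" .
  show "((\<lambda>x. mat_exp (x *\<^sub>R A)) has_vector_derivative A ** mat_exp (x *\<^sub>R A)) (at x)"
  proof (rule has_vector_derivative_matrix)
    fix i j
    define a where "a k = mat_pow A k $ i $ j / fact k" for k
    have E: "mat_exp (y *\<^sub>R A) $ i $ j = (\<Sum>k. a k * complex_of_real y ^ k)" for y
      unfolding a_def by (rule sums_unique[OF mat_exp_entry])
    have "DERIV (\<lambda>z. \<Sum>k. a k * z ^ k) (complex_of_real x) :>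
        (\<Sum>k. diffs a k * complex_of_real x ^ k)"
    proof (rule termdiffs_strong)
      show "summable (\<lambda>k. a k * complex_of_real (\<bar>x\<bar> + 1) ^ k)"
        unfolding a_def by (rule sums_summable[OF mat_exp_entry])
    qed auto
    from field_vector_diff_chain_at[where f = complex_of_real and x = x, OF _ this, of 1]
    have d: "((\<lambda>y. mat_exp (y *\<^sub>R A) $ i $ j) has_vector_derivative
        (\<Sum>k. diffs a k * complex_of_real x ^ k)) (at x)"
      unfolding E[abs_def] using has_vector_derivative_of_real[OF DERIV_ident]
      by (auto simp: o_def)
    \<comment> \<open>the shift of the index turns \<open>A\<^bsup>k+1\<^esup>\<close> into \<open>A\<close> times \<open>A\<^bsup>k\<^esup>\<close>\<close>
    have "diffs a k * complex_of_real x ^ k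
        = (\<Sum>l\<in>UNIV. A $ i $ l * ((mat_pow A k $ l $ j / fact k) * complex_of_real x ^ k))" for k
      by (simp add: diffs_def a_def mat_pow_simps matrix_matrix_mult_def sum_distrib_left
          sum_distrib_right sum_divide_distrib divide_simps mult_ac del: of_nat_Suc)
    moreover have "(\<lambda>k. \<Sum>l\<in>UNIV. A $ i $ l * ((mat_pow A k $ l $ j / fact k) * complex_of_real x ^ k))
        sums (\<Sum>l\<in>UNIV. A $ i $ l * mat_exp (x *\<^sub>R A) $ l $ j)"
      by (intro sums_sum sums_mult mat_exp_entry)
    ultimately have "(\<Sum>k. diffs a k * complex_of_real x ^ k) = (A ** mat_exp (x *\<^sub>R A)) $ i $ j"
      by (simp add: sums_iff matrix_matrix_mult_def)
    with d show "((\<lambda>x. mat_exp (x *\<^sub>R A) $ i $ j) has_vector_derivative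
        (A ** mat_exp (x *\<^sub>R A)) $ i $ j) (at x)" by simp
  qed
qed

section \<open>The Hermite-type weight and its moments\<close>

text \<open>The Pearson equation of the weight. The factor \<open>A\<^sup>*\<close> appears on the right because a matrix
  commutes with its exponential.\<close>
lemma hermite_weight_has_vector_derivative:
  "(hermite_weight A t has_vector_derivative
     A ** hermite_weight A t x + hermite_weight A t x ** cadjoint A
       - (2 * x + t) *\<^sub>R hermite_weight A t x) (at x)"
proof -
  let ?E = "\<lambda>x. mat_exp (x *\<^sub>R A)" and ?F = "\<lambda>x. mat_exp (x *\<^sub>R cadjoint A)"
  have g: "((\<lambda>x. exp (- (x ^ 2) - x * t)) has_vector_derivative
      - (2 * x + t) * exp (- (x ^ 2) - x * t)) (at x)"
    unfolding has_real_derivative_iff_has_vector_derivative[symmetric]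
    by (auto intro!: derivative_eq_intros simp: algebra_simps)
  have "((\<lambda>x. ?E x ** ?F x) has_vector_derivative
      ?E x ** (?F x ** cadjoint A) + (A ** ?E x) ** ?F x) (at x)"
    using mm.has_vector_derivative[OF mat_exp_has_vector_derivative[of A] mat_exp_has_vector_derivative[of "cadjoint A"]]
    by (simp add: mat_exp_commute)
  from has_vector_derivative_scaleR[OF g[unfolded has_real_derivative_iff_has_vector_derivative[symmetric]] this]
  show ?thesis
    unfolding hermite_weight_def[abs_def]
    by (simp add: mm.scaleR_left mm.scaleR_right matrix_mul_assoc algebra_simps)
qed

lemma hermite_weight_bound:
  fixes A :: "complex^'n^'n"
  obtains C c where "C \<ge> 0"
    "\<And>x. norm (hermite_weight A t x) \<le> C * exp (- (x ^ 2) + c * \<bar>x\<bar>)"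
proof -
  obtain K where K: "K \<ge> 0" "\<And>B C :: complex^'n^'n. norm ((B :: complex^'n^'n) ** C) \<le> norm B * norm C * K"
    using mm.nonneg_bounded by blast
  let ?M = "norm (mat 1 :: complex^'n^'n)"
  obtain a where a: "\<And>x. norm (mat_exp (x *\<^sub>R A)) \<le> ?M * exp (a * \<bar>x\<bar>)"
    using norm_mat_exp_le[of A] by blast
  obtain b where b: "\<And>x. norm (mat_exp (x *\<^sub>R cadjoint A)) \<le> ?M * exp (b * \<bar>x\<bar>)"
    using norm_mat_exp_le[of "cadjoint A"] by blast
  have "norm (hermite_weight A t x) \<le> ?M * ?M * K * exp (- (x ^ 2) + (a + b + \<bar>t\<bar>) * \<bar>x\<bar>)" for x
  proof -
    have "norm (mat_exp (x *\<^sub>R A) ** mat_exp (x *\<^sub>R cadjoint A))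
        \<le> (?M * exp (a * \<bar>x\<bar>)) * (?M * exp (b * \<bar>x\<bar>)) * K"
      by (rule order_trans[OF K(2)]) (intro mult_right_mono mult_mono a b K(1); simp)
    moreover have "exp (- (x ^ 2) - x * t) \<le> exp (- (x ^ 2) + \<bar>t\<bar> * \<bar>x\<bar>)"
      by (simp add: abs_mult[symmetric] abs_le_iff mult.commute)
    ultimately have "norm (hermite_weight A t x)
        \<le> exp (- (x ^ 2) + \<bar>t\<bar> * \<bar>x\<bar>) * ((?M * exp (a * \<bar>x\<bar>)) * (?M * exp (b * \<bar>x\<bar>)) * K)"
      unfolding hermite_weight_def norm_scaleR by (intro mult_mono) auto
    also have "\<dots> = ?M * ?M * K * exp (- (x ^ 2) + (a + b + \<bar>t\<bar>) * \<bar>x\<bar>)"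
      by (simp add: exp_add[symmetric] algebra_simps flip: exp_add)
    finally show ?thesis .
  qed
  then show ?thesis using that[of "?M * ?M * K" "a + b + \<bar>t\<bar>"] K(1) by simp
qed

lemma isCont_hermite_weight: "isCont (hermite_weight A t) x"
  using hermite_weight_has_vector_derivative by (rule has_vector_derivative_continuous)

lemma borel_measurable_hermite_weight [measurable]: "hermite_weight A t \<in> borel_measurable borel"
  by (intro borel_measurable_continuous_onI continuous_at_imp_continuous_on ballI isCont_hermite_weight)

lemma hermite_weight_exp_integrable:
  "integrable lborel (\<lambda>x. exp \<bar>d * x\<bar> *\<^sub>R hermite_weight A t x)"
proof -
  obtain C c where C: "C \<ge> 0"
    "\<And>x. norm (hermite_weight A t x) \<le> C * exp (- (x ^ 2) + c * \<bar>x\<bar>)"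
    by (rule hermite_weight_bound[of A t]) blast
  have "integrable lborel (\<lambda>x. C * exp (- (x ^ 2) + (c + \<bar>d\<bar>) * \<bar>x\<bar>))"
    by (intro integrable_mult_right integrable_gaussian_exp)
  then show ?thesis
  proof (rule Bochner_Integration.integrable_bound)
    show "AE x in lborel. norm (exp \<bar>d * x\<bar> *\<^sub>R hermite_weight A t x)
        \<le> norm (C * exp (- (x ^ 2) + (c + \<bar>d\<bar>) * \<bar>x\<bar>))"
    proof (rule AE_I2)
      fix x :: real
      have "norm (exp \<bar>d * x\<bar> *\<^sub>R hermite_weight A t x)
          \<le> exp \<bar>d * x\<bar> * (C * exp (- (x ^ 2) + c * \<bar>x\<bar>))"
        unfolding norm_scaleR using C(2)[of x] by (intro mult_mono) auto
      then show "norm (exp \<bar>d * x\<bar> *\<^sub>R hermite_weight A t x)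
          \<le> norm (C * exp (- (x ^ 2) + (c + \<bar>d\<bar>) * \<bar>x\<bar>))"
        using C(1) by (simp add: exp_add[symmetric] algebra_simps abs_mult flip: exp_add)
    qed
  qed measurable
qed

lemma hermite_weight_moment_integrable:
  "integrable lborel (\<lambda>x. x ^ k *\<^sub>R hermite_weight A t x)"
proof (rule Bochner_Integration.integrable_bound)
  show "integrable lborel (\<lambda>x. fact k *\<^sub>R (exp \<bar>1 * x\<bar> *\<^sub>R hermite_weight A t x))"
    by (intro integrable_scaleR_right hermite_weight_exp_integrable)
  show "AE x in lborel. norm (x ^ k *\<^sub>R hermite_weight A t x)
      \<le> norm (fact k *\<^sub>R (exp \<bar>1 * x\<bar> *\<^sub>R hermite_weight A t x))"
    using power_le_fact_exp_abs
    by (intro AE_I2) (simp add: power_abs mult.assoc[symmetric] mult_right_mono)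
qed measurable

text \<open>These are the boundary terms in the integration by parts below.\<close>
lemma hermite_weight_vanishes:
  assumes "F = at_top \<or> F = at_bot"
  shows "((\<lambda>x. x ^ k *\<^sub>R hermite_weight A t x) \<longlongrightarrow> 0) F"
proof -
  obtain C c where C: "C \<ge> 0"
    "\<And>x. norm (hermite_weight A t x) \<le> C * exp (- (x ^ 2) + c * \<bar>x\<bar>)"
    by (rule hermite_weight_bound[of A t]) blast
  define B where "B = fact k * C * exp ((c + 2) ^ 2)"
  have "((\<lambda>x::real. exp (- \<bar>x\<bar>)) \<longlongrightarrow> 0) F"
    using assms by (elim disjE; hypsubst; real_asymp)
  then have lim: "((\<lambda>x. B * exp (- \<bar>x\<bar>)) \<longlongrightarrow> 0) F" by (rule tendsto_mult_right_zero)
  have "norm (x ^ k *\<^sub>R hermite_weight A t x) \<le> norm (B * exp (- \<bar>x\<bar>)) * 1" for x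
  proof -
    have "norm (x ^ k *\<^sub>R hermite_weight A t x)
        \<le> (fact k * exp \<bar>x\<bar>) * (C * exp (- (x ^ 2) + c * \<bar>x\<bar>))"
      unfolding norm_scaleR real_norm_def power_abs
      by (intro mult_mono power_le_fact_exp_abs C(2)) auto
    also have "\<dots> = fact k * C * exp (\<bar>x\<bar> + (- (x ^ 2) + c * \<bar>x\<bar>))"
      by (simp only: exp_add mult_ac)
    also have "\<dots> \<le> fact k * C * exp ((c + 2) ^ 2 + - \<bar>x\<bar>)"
    proof -
      \<comment> \<open>completing the square in \<open>(c + 2) \<bar>x\<bar> - x\<^sup>2\<close>\<close>
      have "0 \<le> (\<bar>x\<bar> - (c + 2) / 2) ^ 2 + 3 * (c + 2) ^ 2 / 4" by simp
      then have "\<bar>x\<bar> + (- (x ^ 2) + c * \<bar>x\<bar>) \<le> (c + 2) ^ 2 + - \<bar>x\<bar>"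
        by (simp add: power2_eq_square field_simps)
      then show ?thesis using C(1) by (intro mult_left_mono) auto
    qed
    also have "\<dots> = B * exp (- \<bar>x\<bar>)" by (simp only: B_def exp_add mult_ac)
    finally show ?thesis by (simp add: abs_le_iff)
  qed
  then show ?thesis by (rule tendsto_0_le[OF lim always_eventually[OF allI]])
qed

text \<open>The integral over the line of the derivative of \<open>x\<^sup>k V(x)\<close> vanishes; the Pearson equation
  expresses this derivative by \<open>V\<close> itself. For \<open>k = 0\<close> the term with the truncated index \<open>k - 1\<close>
  has coefficient 0.\<close>
lemma hermite_moment_recursion:
  fixes A :: "complex^'n^'n" and t :: real
  defines "M \<equiv> \<lambda>k. LINT x|lebesgue. x ^ k *\<^sub>R hermite_weight A t x"
  shows "real k *\<^sub>R M (k - 1) + A ** M k + M k ** cadjoint A = 2 *\<^sub>R M (Suc k) + t *\<^sub>R M k"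
proof -
  let ?V = "hermite_weight A t"
  have M: "M k = (LINT x|lborel. x ^ k *\<^sub>R ?V x)" for k
    unfolding M_def by (rule integral_completion) measurable
  define f where "f x = real k *\<^sub>R (x ^ (k - 1) *\<^sub>R ?V x) + A ** (x ^ k *\<^sub>R ?V x)
      + (x ^ k *\<^sub>R ?V x) ** cadjoint A - 2 *\<^sub>R (x ^ Suc k *\<^sub>R ?V x) - t *\<^sub>R (x ^ k *\<^sub>R ?V x)" for x
  have int: "integrable lborel f"
    unfolding f_def
    by (intro Bochner_Integration.integrable_add Bochner_Integration.integrable_diff
        integrable_scaleR_right hermite_weight_moment_integrable
        integrable_bounded_linear[OF mm.bounded_linear_right]
        integrable_bounded_linear[OF mm.bounded_linear_left])
  have "(LBINT x=-\<infinity>..\<infinity>. f x) = 0 - 0"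
  proof (rule interval_integral_FTC_integrable)
    fix x
    have "((\<lambda>x. x ^ k) has_real_derivative real k * x ^ (k - 1)) (at x)"
      by (auto intro!: derivative_eq_intros)
    from has_vector_derivative_scaleR[OF this hermite_weight_has_vector_derivative[of A t x]]
    show "((\<lambda>x. x ^ k *\<^sub>R ?V x) has_vector_derivative f x) (at x)"
      by (simp add: f_def mm.scaleR_left mm.scaleR_right algebra_simps)
    show "isCont f x"
      unfolding f_def
      by (intro continuous_intros mm.continuous isCont_hermite_weight)
  next
    show "set_integrable lborel (einterval (-\<infinity>) \<infinity>) f"
      using int by (simp add: set_integrable_def)
    show "(((\<lambda>x. x ^ k *\<^sub>R ?V x) \<circ> real_of_ereal) \<longlongrightarrow> 0) (at_right (-\<infinity>))"
      "(((\<lambda>x. x ^ k *\<^sub>R ?V x) \<circ> real_of_ereal) \<longlongrightarrow> 0) (at_left \<infinity>)"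
      by (simp_all add: ereal_tendsto_simps hermite_weight_vanishes)
  qed simp
  then have "(LINT x|lborel. f x) = 0"
    by (simp add: interval_lebesgue_integral_def set_lebesgue_integral_def)
  also have "(LINT x|lborel. f x) = real k *\<^sub>R M (k - 1) + A ** M k + M k ** cadjoint A
      - 2 *\<^sub>R M (Suc k) - t *\<^sub>R M k"
    unfolding f_def M
    by (simp only: Bochner_Integration.integral_add Bochner_Integration.integral_diff
        integral_scaleR_right hermite_weight_moment_integrable
        Bochner_Integration.integrable_add Bochner_Integration.integrable_diff
        integrable_scaleR_right
        integrable_bounded_linear[OF mm.bounded_linear_right]
        integrable_bounded_linear[OF mm.bounded_linear_left]
        integral_bounded_linear[OF mm.bounded_linear_right]
        integral_bounded_linear[OF mm.bounded_linear_left])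
  finally show ?thesis by (simp add: algebra_simps)
qed

section \<open>The moments of a weight with the given adjoint\<close>

lemma cadjoint_nth: "cadjoint X $ i $ j = cnj (X $ j $ i)"
  by (simp add: cadjoint_def transpose_def)

lemma cadjoint_mat_1: "cadjoint (mat 1) = mat 1"
  by (simp add: vec_eq_iff cadjoint_nth mat_def)

lemma rat_of_mat_poly_add: "rat_of_mat_poly (F + G) = rat_of_mat_poly F + rat_of_mat_poly G"
  by (simp add: rat_of_mat_poly_def vec_eq_iff)

lemma to_fract_sum: "to_fract (sum f S) = (\<Sum>x\<in>S. to_fract (f x))"
  by (induction S rule: infinite_finite_induct) auto

lemma rat_of_mat_poly_mult: "rat_of_mat_poly (F ** G) = rat_of_mat_poly F ** rat_of_mat_poly G"
  by (simp add: rat_of_mat_poly_def vec_eq_iff matrix_matrix_mult_def to_fract_sum)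

lemma rat_of_mat_poly_mat: "rat_of_mat_poly (mat p) = mat (to_fract p)"
  by (simp add: rat_of_mat_poly_def vec_eq_iff mat_def)

lemma eval_mat_rat_of_mat_poly: "eval_mat_rat (rat_of_mat_poly F) x = eval_mat_poly F x"
  by (simp add: eval_mat_rat_def rat_of_mat_poly_def eval_mat_poly_def eval_rat_def vec_eq_iff)

lemma eval_mat_poly_mat: "eval_mat_poly (mat p) x = mat (poly p (complex_of_real x))"
  by (simp add: eval_mat_poly_def vec_eq_iff mat_def)

lemma eval_mat_poly_const_mat: "eval_mat_poly (const_mat A) x = A"
  by (simp add: eval_mat_poly_def const_mat_def vec_eq_iff)

lemma eval_mat_poly_add: "eval_mat_poly (F + G) x = eval_mat_poly F x + eval_mat_poly G x"
  and eval_mat_poly_diff: "eval_mat_poly (F - G) x = eval_mat_poly F x - eval_mat_poly G x"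
  by (simp_all add: eval_mat_poly_def vec_eq_iff)

lemma eval_mat_poly_mult: "eval_mat_poly (F ** G) x = eval_mat_poly F x ** eval_mat_poly G x"
  by (simp add: eval_mat_poly_def vec_eq_iff matrix_matrix_mult_def poly_sum)

lemma mat_of_real_mult:
  fixes X :: "complex^'n^'n"
  shows "mat (complex_of_real r) ** X = r *\<^sub>R X" "X ** mat (complex_of_real r) = r *\<^sub>R X"
  by (simp_all add: vec_eq_iff matrix_matrix_mult_def mat_def if_distrib if_distribR sum.delta'
      scaleR_conv_of_real[where 'a = complex] mult.commute cong: if_cong)

lemma act_first_order:
  assumes "degree D \<le> 1"
  shows "act F D = rat_of_mat_poly F ** coeff D 0 + rat_of_mat_poly (map_matrix pderiv F) ** coeff D 1"
proof -
  have "act F D = (\<Sum>j\<le>1. rat_of_mat_poly ((map_matrix pderiv ^^ j) F) ** coeff D j)"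
    unfolding act_def
    by (rule sum.mono_neutral_left) (use assms in \<open>auto simp: not_le coeff_eq_0\<close>)
  then show ?thesis by simp
qed

text \<open>The adjoint identity is tested against \<open>F = x\<^sup>k I\<close> and \<open>G = I\<close>. All coefficients are
  polynomials, so no poles occur and the actions evaluate to
  \<open>F \<cdot> D = x\<^sup>k A + k x\<^bsup>k-1\<^esup> I\<close> and \<open>G \<cdot> D\<^sup>\<dagger> = (2 x + t) I - A\<close>.\<close>
lemma adjoint_moment_recursion:
  fixes A :: "complex^'n^'n" and t :: real and W :: "real \<Rightarrow> complex^'n^'n"
  defines "M \<equiv> \<lambda>k. LINT x|lebesgue. x ^ k *\<^sub>R W x"
  assumes mom: "\<And>k. integrable lebesgue (\<lambda>x. x ^ k *\<^sub>R W x)"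
    and D: "D = [: rat_of_mat_poly (const_mat A), mat 1 :]"
    and adj: "is_adjoint W D (- D + [: mat (to_fract [: complex_of_real t, 2 :]) :])"
  shows "real k *\<^sub>R M (k - 1) + A ** M k + M k ** cadjoint A = 2 *\<^sub>R M (Suc k) + t *\<^sub>R M k"
proof -
  let ?E = "- D + [: mat (to_fract [: complex_of_real t, 2 :]) :]"
  let ?F = "mat (monom 1 k) :: complex poly^'n^'n"
  let ?G = "mat 1 :: complex poly^'n^'n"
  have dF: "map_matrix pderiv ?F = mat (monom (of_nat k) (k - 1))"
    by (simp add: vec_eq_iff mat_def pderiv_monom)
  have dG: "map_matrix pderiv ?G = mat 0"
    by (simp add: vec_eq_iff mat_def)
  have actF: "act ?F D = rat_of_mat_poly (?F ** const_mat A + mat (monom (of_nat k) (k - 1)))"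
    unfolding D by (subst act_first_order) (simp_all add: dF rat_of_mat_poly_add rat_of_mat_poly_mult)
  have degE: "degree ?E \<le> 1"
    unfolding D by (intro degree_add_le) (auto intro: order_trans[OF degree_pCons_le])
  have actG: "act ?G ?E = rat_of_mat_poly (mat [: complex_of_real t, 2 :] - const_mat A)"
    unfolding act_first_order[OF degE] dG
    by (simp add: D rat_of_mat_poly_mat[of 1, simplified])
      (simp add: rat_of_mat_poly_def mat_def vec_eq_iff matrix_matrix_mult_def)
  have evF: "eval_mat_poly ?F x = mat (complex_of_real (x ^ k))" for x
    by (simp add: eval_mat_poly_mat poly_monom)
  have evG: "eval_mat_poly ?G x = mat 1" for x
    by (simp add: eval_mat_poly_mat)
  have evFD: "eval_mat_rat (act ?F D) x = x ^ k *\<^sub>R A + mat (complex_of_real (real k * x ^ (k - 1)))" for x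
    unfolding actF eval_mat_rat_of_mat_poly eval_mat_poly_add eval_mat_poly_mult evF eval_mat_poly_const_mat
      mat_of_real_mult
    by (simp add: eval_mat_poly_mat poly_monom)
  have evGE: "cadjoint (eval_mat_rat (act ?G ?E) x)
      = mat (complex_of_real (2 * x + t)) - cadjoint A" for x
    unfolding actG eval_mat_rat_of_mat_poly eval_mat_poly_diff eval_mat_poly_const_mat eval_mat_poly_mat
    by (simp add: vec_eq_iff cadjoint_nth mat_def)
  note lin = Bochner_Integration.integral_add Bochner_Integration.integral_diff
        integral_scaleR_right mom
        Bochner_Integration.integrable_add Bochner_Integration.integrable_diff
        integrable_scaleR_right
        integrable_bounded_linear[OF mm.bounded_linear_right]
        integrable_bounded_linear[OF mm.bounded_linear_left]
        integral_bounded_linear[OF mm.bounded_linear_right]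
        integral_bounded_linear[OF mm.bounded_linear_left]
  have "weight_inner W (eval_mat_rat (act ?F D)) (eval_mat_poly ?G)
      = (LINT x|lebesgue. A ** (x ^ k *\<^sub>R W x) + real k *\<^sub>R (x ^ (k - 1) *\<^sub>R W x))"
    unfolding weight_inner_def evFD evG cadjoint_mat_1
    by (simp add: mm.add_left mm.scaleR_left mm.scaleR_right mat_of_real_mult del: of_real_mult of_real_power)
  also have "\<dots> = A ** M k + real k *\<^sub>R M (k - 1)"
    unfolding M_def by (simp only: lin)
  finally have L: "weight_inner W (eval_mat_rat (act ?F D)) (eval_mat_poly ?G)
      = A ** M k + real k *\<^sub>R M (k - 1)" .
  have "weight_inner W (eval_mat_poly ?F) (eval_mat_rat (act ?G ?E))
      = (LINT x|lebesgue. 2 *\<^sub>R (x ^ Suc k *\<^sub>R W x) + t *\<^sub>R (x ^ k *\<^sub>R W x) - (x ^ k *\<^sub>R W x) ** cadjoint A)"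
    unfolding weight_inner_def evGE evF
    by (simp add: mm.diff_right mm.scaleR_left mm.scaleR_right mat_of_real_mult algebra_simps
        del: of_real_mult of_real_power of_real_add)
  also have "\<dots> = 2 *\<^sub>R M (Suc k) + t *\<^sub>R M k - M k ** cadjoint A"
    unfolding M_def by (simp only: lin)
  finally have R: "weight_inner W (eval_mat_poly ?F) (eval_mat_rat (act ?G ?E))
      = 2 *\<^sub>R M (Suc k) + t *\<^sub>R M k - M k ** cadjoint A" .
  have "weight_inner W (eval_mat_rat (act ?F D)) (eval_mat_poly ?G)
      = weight_inner W (eval_mat_poly ?F) (eval_mat_rat (act ?G ?E))"
    using adj unfolding is_adjoint_def by blast
  then show ?thesis unfolding L R by (simp add: algebra_simps)
qed

lemma moments_eq_if_same_recursion:
  fixes M M' :: "nat \<Rightarrow> complex^'n^'n"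
  assumes "\<And>k. real k *\<^sub>R M (k - 1) + A ** M k + M k ** B = 2 *\<^sub>R M (Suc k) + t *\<^sub>R M k"
    and "\<And>k. real k *\<^sub>R M' (k - 1) + A ** M' k + M' k ** B = 2 *\<^sub>R M' (Suc k) + t *\<^sub>R M' k"
    and "M 0 = M' 0"
  shows "M k = M' k"
proof (induction k rule: less_induct)
  case (less k)
  show ?case
  proof (cases k)
    case (Suc j)
    then have "M j = M' j" "M (j - 1) = M' (j - 1)" using less by auto
    then have "2 *\<^sub>R M (Suc j) = 2 *\<^sub>R M' (Suc j)"
      using assms(1,2)[of j] by (metis add_right_cancel)
    then show ?thesis using Suc by simp
  qed (use assms in simp)
qed

section \<open>Entries of positive definite matrices\<close>

text \<open>The quadratic form at \<open>e\<^sub>i + z e\<^sub>j\<close>. The case \<open>i = j\<close> is included, where this vector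
  may be zero and the form vanishes.\<close>
lemma pos_def_quadratic_form_two:
  assumes "pos_def X"
  shows "0 \<le> Re (X $ i $ i + z * X $ i $ j + cnj z * X $ j $ i + cnj z * z * X $ j $ j)"
proof -
  define v where "v = axis i 1 + axis j z"
  have v: "v $ k = (if k = i then 1 else 0) + (if k = j then z else 0)" for k
    by (simp add: v_def axis_def)
  have sum_v: "(\<Sum>l\<in>UNIV. f l * v $ l) = f i + f j * z"
    and sum_cnj_v: "(\<Sum>l\<in>UNIV. cnj (v $ l) * f l) = f i + cnj z * f j" for f
    by (simp_all add: v distrib_left distrib_right sum.distrib if_distrib[of cnj]
        if_distrib[of "\<lambda>x. x * _"] if_distrib[of "\<lambda>x. _ * x"] sum.delta sum.delta' cong: if_cong)
  have "(\<Sum>k\<in>UNIV. \<Sum>l\<in>UNIV. cnj (v $ k) * X $ k $ l * v $ l)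
      = (\<Sum>k\<in>UNIV. cnj (v $ k) * (\<Sum>l\<in>UNIV. X $ k $ l * v $ l))"
    by (simp add: sum_distrib_left mult.assoc)
  also have "\<dots> = X $ i $ i + z * X $ i $ j + cnj z * X $ j $ i + cnj z * z * X $ j $ j"
    unfolding sum_v sum_cnj_v by (simp add: algebra_simps)
  finally have "(\<Sum>k\<in>UNIV. \<Sum>l\<in>UNIV. cnj (v $ k) * X $ k $ l * v $ l)
      = X $ i $ i + z * X $ i $ j + cnj z * X $ j $ i + cnj z * z * X $ j $ j" .
  moreover have "0 \<le> Re (\<Sum>k\<in>UNIV. \<Sum>l\<in>UNIV. cnj (v $ k) * X $ k $ l * v $ l)"
    using assms unfolding pos_def_def by (cases "v = 0") (auto intro: less_imp_le)
  ultimately show ?thesis by simp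
qed

text \<open>Choosing the phase of \<open>z\<close> opposite to that of \<open>X\<^sub>i\<^sub>j\<close> makes the mixed terms of the quadratic
  form equal to \<open>- 2 \<bar>X\<^sub>i\<^sub>j\<bar>\<close>, so \<open>2 \<bar>X\<^sub>i\<^sub>j\<bar> \<le> X\<^sub>i\<^sub>i + X\<^sub>j\<^sub>j\<close>. Unlike the sharper
  bound by the geometric mean, this dominates all entries by one linear function of \<open>X\<close>, whose
  moments are known.\<close>
lemma pos_def_norm_entry_le_trace:
  fixes X :: "complex^'n^'n"
  assumes X: "pos_def X"
  shows "norm (X $ i $ j) \<le> Re (trace X)"
proof -
  have herm: "X $ l $ k = cnj (X $ k $ l)" for k l
    using X unfolding pos_def_def by (metis cadjoint_nth)
  have diag: "0 \<le> Re (X $ k $ k)" for k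
    using pos_def_quadratic_form_two[OF X, of k 0] by simp
  have diag_le: "Re (X $ k $ k) \<le> Re (trace X)" for k
    unfolding trace_def Re_sum by (rule member_le_sum) (use diag in auto)
  have "norm (X $ i $ j) \<le> (Re (X $ i $ i) + Re (X $ j $ j)) / 2"
  proof (cases "X $ i $ j = 0")
    case True
    then show ?thesis using diag[of i] diag[of j] by simp
  next
    case False
    define r where "r = norm (X $ i $ j)"
    define z where "z = - cnj (X $ i $ j) / r"
    have r: "r > 0" using False by (simp add: r_def)
    have sq: "cnj (X $ i $ j) * X $ i $ j = complex_of_real (r * r)"
      by (simp add: r_def complex_norm_square[symmetric] power2_eq_square[symmetric] mult.commute)
    have zX: "z * X $ i $ j = - complex_of_real r"
      using r sq by (simp add: z_def)
    have "cnj z * X $ j $ i = cnj (z * X $ i $ j)" using herm[of j i] by simp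
    also have "\<dots> = - complex_of_real r" unfolding zX by simp
    finally have zX': "cnj z * X $ j $ i = - complex_of_real r" .
    have zz: "cnj z * z = 1"
      using r sq by (simp add: z_def mult.commute)
    from pos_def_quadratic_form_two[OF X, of i z j] show ?thesis
      unfolding zX zX' zz by (simp add: r_def)
  qed
  also have "\<dots> \<le> (Re (trace X) + Re (trace X)) / 2"
    by (intro divide_right_mono add_mono diag_le) simp
  finally show ?thesis by simp
qed

section \<open>Characterization of the Hermite-type weight\<close>

theorem theorem5p2:
  fixes t :: real
    and Wt :: "real \<Rightarrow> complex^'n^'n"
    and P :: "nat \<Rightarrow> complex poly^'n^'n"
    and A :: "complex^'n^'n"
    and D :: "(complex poly fract^'n^'n) poly"
  assumes weight: "matrix_weight Wt"
    and orth: "monic_orthogonal Wt P"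
    and D: "D = [: rat_of_mat_poly (const_mat A), mat 1 :]"
    and fourier: "D \<in> right_fourier P"
    and adj: "is_adjoint Wt D (- D + [: mat (to_fract [: complex_of_real t, 2 :]) :])"
    and H0: "sq_norm_seq Wt P 0 = (LINT x|lebesgue. Wt x)"
    and H0_eq: "(LINT x|lebesgue. Wt x) = (LINT x|lebesgue. hermite_weight A t x)"
  shows "\<exists>K :: complex^'n^'n. invertible K \<and>
           (AE x in lebesgue. hermite_weight A t x = K ** Wt x ** cadjoint K)"
proof -
  let ?V = "hermite_weight A t"
  have pd: "AE x in lebesgue. pos_def (Wt x)"
    and momW: "\<And>k. integrable lebesgue (\<lambda>x. x ^ k *\<^sub>R Wt x)"
    using weight unfolding matrix_weight_def by auto
  have momV: "integrable lebesgue (\<lambda>x. x ^ k *\<^sub>R ?V x)" for k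
    by (subst integrable_completion) (simp_all add: hermite_weight_moment_integrable)
  have expV: "integrable lebesgue (\<lambda>x. exp \<bar>c * x\<bar> *\<^sub>R ?V x)" for c
    by (subst integrable_completion) (simp_all add: hermite_weight_exp_integrable)
  have moments: "(LINT x|lebesgue. x ^ k *\<^sub>R Wt x) = (LINT x|lebesgue. x ^ k *\<^sub>R ?V x)" for k
    by (rule moments_eq_if_same_recursion[OF adjoint_moment_recursion[OF momW D adj]
          hermite_moment_recursion]) (simp add: H0_eq)
  \<comment> \<open>linear functionals reduce the comparison to scalar weights; they are applied to the trace
      and to the real and imaginary parts of the entries\<close>
  have lin_moments: "(LINT x|lebesgue. x ^ k * L (Wt x)) = (LINT x|lebesgue. x ^ k * L (?V x))"
    and lin_int: "integrable lebesgue (\<lambda>x. x ^ k * L (Wt x))" "integrable lebesgue (\<lambda>x. x ^ k * L (?V x))"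
      "integrable lebesgue (\<lambda>x. exp \<bar>c * x\<bar> * L (?V x))"
    if L: "bounded_linear L" for L :: "complex^'n^'n \<Rightarrow> real" and k c
    using moments[of k] integral_bounded_linear[OF L momW[of k]] integral_bounded_linear[OF L momV[of k]]
      integrable_bounded_linear[OF L momW[of k]] integrable_bounded_linear[OF L momV[of k]]
      integrable_bounded_linear[OF L expV[of c]]
    by (simp_all add: linear_simps[OF L])
  have trace: "bounded_linear (\<lambda>X :: complex^'n^'n. Re (trace X))"
    unfolding trace_def
    by (intro bounded_linear_compose[OF bounded_linear_Re] bounded_linear_sum bounded_linear_entry)
  have exp_trace: "integrable lebesgue (\<lambda>x. exp \<bar>c * x\<bar> * Re (trace (Wt x)))" for c
  proof (rule exp_integrable_if_moments_eq)
    show "AE x in lebesgue. 0 \<le> Re (trace (Wt x))"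
      using pd by eventually_elim (rule order_trans[OF norm_ge_zero pos_def_norm_entry_le_trace])
  qed (rule lin_int[OF trace] lin_moments[OF trace])+
  have scalar: "AE x in lebesgue. L (Wt x) - L (?V x) = 0"
    if L: "bounded_linear L" and le: "\<And>X. \<bar>L X\<bar> \<le> norm (X $ i $ j)"
    for L :: "complex^'n^'n \<Rightarrow> real" and i j
  proof (rule lebesgue_AE_zero_if_moments_zero)
    fix c :: real
    have [measurable]: "(\<lambda>x. L (Wt x)) \<in> borel_measurable lebesgue"
      using lin_int(1)[OF L, of 0] by auto
    have [measurable]: "(\<lambda>x. exp \<bar>c * x\<bar>) \<in> borel_measurable lebesgue"
      by (rule measurable_completion) measurable
    have "integrable lebesgue (\<lambda>x. exp \<bar>c * x\<bar> * L (Wt x))"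
    proof (rule Bochner_Integration.integrable_bound[OF exp_trace])
      show "AE x in lebesgue. norm (exp \<bar>c * x\<bar> * L (Wt x)) \<le> norm (exp \<bar>c * x\<bar> * Re (trace (Wt x)))"
        using pd
      proof eventually_elim
        case (elim x)
        have "\<bar>L (Wt x)\<bar> \<le> \<bar>Re (trace (Wt x))\<bar>"
          using le[of "Wt x"] pos_def_norm_entry_le_trace[OF elim, of i j] by linarith
        then show ?case by (simp add: abs_mult mult_left_mono)
      qed
    qed measurable
    from Bochner_Integration.integrable_diff[OF this lin_int(3)[OF L, of c]]
    show "integrable lebesgue (\<lambda>x. exp \<bar>c * x\<bar> * (L (Wt x) - L (?V x)))"
      by (simp add: right_diff_distrib)
  next
    fix k
    show "(LINT x|lebesgue. x ^ k * (L (Wt x) - L (?V x))) = 0"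
      by (simp add: right_diff_distrib lin_int[OF L] lin_moments[OF L])
  qed
  have "AE x in lebesgue. \<forall>i j. Re (Wt x $ i $ j) - Re (?V x $ i $ j) = 0
      \<and> Im (Wt x $ i $ j) - Im (?V x $ i $ j) = 0"
    unfolding AE_all_countable
    by (intro allI AE_conjI; rule scalar[OF bounded_linear_compose[OF bounded_linear_Re bounded_linear_entry]]
        scalar[OF bounded_linear_compose[OF bounded_linear_Im bounded_linear_entry]])
      (rule abs_Re_le_cmod abs_Im_le_cmod)+
  then have "AE x in lebesgue. ?V x = mat 1 ** Wt x ** cadjoint (mat 1)"
  proof eventually_elim
    case (elim x)
    then have "?V x = Wt x" by (simp add: vec_eq_iff complex_eq_iff)
    then show ?case by (simp add: cadjoint_mat_1)
  qed
  moreover have "invertible (mat 1 :: complex^'n^'n)"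
    unfolding invertible_def by (intro exI[of _ "mat 1"]) simp
  ultimately show ?thesis by blast
qed

end
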